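(* Let $f_{\theta},g_{\theta}:\mathbb{R}^n\times\mathbb{R}^k\to\mathbb{R}$, $\theta\in\Theta$, be parametric families of objective and constraint functions, and let $\ell^{\mathrm p}_\theta$ and $\ell^{\mathrm{sub}}_\theta$ be the predictability and suboptimality losses defined in the context. For any $\theta\in\Theta$ and any data pair $(x,s)\in\mathbb{R}^n\times\mathbb{R}^k$ generated by the forward model, both losses $\ell_\theta=\ell^{\mathrm p}_\theta$ and $\ell_\theta=\ell^{\mathrm{sub}}_\theta$ satisfy $$\ell_\theta(x,s)=0\iff x\in\operatorname*{arg\,min}_{y\in\mathbb{R}^n}\{f_\theta(y,s)\,:\,g_\theta(y,s)\le 0\}.$$
   Context: The forward model is $\min_{x\in\mathbb{R}^n} f(x,s)$ subject to $g(x,s)\le 0$, with unknown functions $f,g$ and input signal $s\in\mathbb{R}^k$; a data pair $(x,s)$ consists of a signal $s$ and an observed optimal decision $x\in\mathbb{R}^n$, where the observation may be contaminated by noise (so $x$ need not be exactly optimal in the forward model). $\Theta$ is a finite-dimensional parameter set. For $\theta\in\Theta$ define $$J_\theta(x,s):=f_\theta(x,s)-\min_{y\in\mathbb{R}^n}\{f_\theta(y,s): g_\theta(y,s)\le 0\}.$$ The predictability loss is $$\ell^{\mathrm p}_\theta(x,s):=\min\{\|\gamma\| : \gamma\in\mathbb{R}^n,\ g_\theta(x+\gamma,s)\le 0,\ J_\theta(x+\gamma,s)\le 0\}.$$ The suboptimality loss is $$\ell^{\mathrm{sub}}_\theta(x,s):=\min\{\|(\gamma_f,\gamma_o)\| :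 \gamma_f,\gamma_o\in\mathbb{R}_+,\ g_\theta(x,s)\le\gamma_f,\ J_\theta(x,s)\le\gamma_o\}.$$ Here $\|\cdot\|$ denotes a norm on the respective space. Conventions: the minimum of an infeasible problem is $+\infty$; the minima defining the losses are understood to be attained whenever the corresponding feasible set is nonempty; the inner minimum in $J_\theta$ is the (extended real) optimal value. *)

theory Defs
  imports "HOL-Analysis.Analysis"
begin

(* The type class norm of the library fixes one norm per type; here norms are arbitrary. *)
definition is_norm :: "('a::real_vector \<Rightarrow> real) \<Rightarrow> bool" where
  "is_norm N \<longleftrightarrow>
     (\<forall>x. 0 \<le> N x) \<and> (\<forall>x. N x = 0 \<longleftrightarrow> x = 0) \<and>
     (\<forall>c x. N (c *\<^sub>R x) = \<bar>c\<bar> * N x) \<and> (\<forall>x y. N (x + y) \<le> N x + N y)"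

(* Extended real optimal value: \<infinity> if S is empty, -\<infinity> if the problem is unbounded below.
   It is a minimum only if it is attained. *)
definition opt_value :: "('a \<Rightarrow> real) \<Rightarrow> 'a set \<Rightarrow> ereal" where
  "opt_value h S = (INF z\<in>S. ereal (h z))"

(* Attainment is required only if S is nonempty. *)
definition min_attained :: "('a \<Rightarrow> real) \<Rightarrow> 'a set \<Rightarrow> bool" where
  "min_attained h S \<longleftrightarrow> (S \<noteq> {} \<longrightarrow> (\<exists>z. is_arg_min h (\<lambda>w. w \<in> S) z))"

(* In the definitions below, F and G are the objective and constraint functions for one
   fixed parameter. *)

(* The value is -\<infinity> if the program for s is infeasible, \<infinity> if it is unbounded below. *)
definition subopt_gap ::
  "('x \<Rightarrow> 's \<Rightarrow> real) \<Rightarrow> ('x \<Rightarrow> 's \<Rightarrow> real) \<Rightarrow> 'x \<Rightarrow> 's \<Rightarrow> ereal" where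
  "subopt_gap F G x s = ereal (F x s) - opt_value (\<lambda>y. F y s) {y. G y s \<le> 0}"

definition pred_feasible ::
  "('x::real_vector \<Rightarrow> 's \<Rightarrow> real) \<Rightarrow> ('x \<Rightarrow> 's \<Rightarrow> real) \<Rightarrow> 'x \<Rightarrow> 's \<Rightarrow> 'x set" where
  "pred_feasible F G x s = {\<gamma>. G (x + \<gamma>) s \<le> 0 \<and> subopt_gap F G (x + \<gamma>) s \<le> 0}"

definition predictability_loss ::
  "('x::real_vector \<Rightarrow> real) \<Rightarrow> ('x \<Rightarrow> 's \<Rightarrow> real) \<Rightarrow> ('x \<Rightarrow> 's \<Rightarrow> real) \<Rightarrow> 'x \<Rightarrow> 's \<Rightarrow> ereal" where
  "predictability_loss N F G x s = opt_value N (pred_feasible F G x s)"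

(* For fixed x and s this is either empty or a translated closed quadrant, so every norm attains
   its minimum on it; pred_feasible, in contrast, need not be closed. *)
definition sub_feasible ::
  "('x \<Rightarrow> 's \<Rightarrow> real) \<Rightarrow> ('x \<Rightarrow> 's \<Rightarrow> real) \<Rightarrow> 'x \<Rightarrow> 's \<Rightarrow> (real \<times> real) set" where
  "sub_feasible F G x s =
     {(\<gamma>f, \<gamma>o). 0 \<le> \<gamma>f \<and> 0 \<le> \<gamma>o \<and> G x s \<le> \<gamma>f \<and> subopt_gap F G x s \<le> ereal \<gamma>o}"

definition suboptimality_loss ::
  "(real \<times> real \<Rightarrow> real) \<Rightarrow> ('x \<Rightarrow> 's \<Rightarrow> real) \<Rightarrow> ('x \<Rightarrow> 's \<Rightarrow> real) \<Rightarrow> 'x \<Rightarrow> 's \<Rightarrow> ereal" where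
  "suboptimality_loss M F G x s = opt_value M (sub_feasible F G x s)"

end

theory Submission
  imports Defs
begin

text \<open>
  Both losses are the least norm on a set of corrections, and the zero correction belongs to either
  set exactly when \<open>x\<close> is feasible with suboptimality gap at most \<open>0\<close>, that is, when \<open>x\<close> is a
  minimizer of the forward model. What remains is that a set of corrections has optimal
  norm \<open>0\<close> if and only if it contains \<open>0\<close>. This is definiteness of the norm if the minimum is
  attained (predictability). It also holds for every closed set (suboptimality): all norms
  on a finite-dimensional space are equivalent, so elements of small norm accumulate at \<open>0\<close>.
\<close>

lemma is_norm_zero: "is_norm N \<Longrightarrow> N 0 = 0"
  by (simp add: is_norm_def)

text \<open>
  One half of the equivalence of norms. A norm is convex, hence continuous in finite
  dimension, so it has a positive minimum on the unit sphere, and homogeneity does the rest.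
\<close>

lemma is_norm_lower_bound:
  fixes N :: "'a::euclidean_space \<Rightarrow> real"
  assumes "is_norm N"
  obtains c where "c > 0" and "\<And>z. c * norm z \<le> N z"
proof -
  have pos: "N z > 0" if "z \<noteq> 0" for z
    using assms that unfolding is_norm_def by (metis less_le)
  have scale: "N (a *\<^sub>R z) = \<bar>a\<bar> * N z" and tri: "N (z + w) \<le> N z + N w" for a z w
    using assms unfolding is_norm_def by blast+
  have "convex_on UNIV N"
  proof (rule convex_onI)
    fix t z w assume "0 < t" "t < (1::real)"
    then show "N ((1 - t) *\<^sub>R z + t *\<^sub>R w) \<le> (1 - t) * N z + t * N w"
      using tri[of "(1 - t) *\<^sub>R z" "t *\<^sub>R w"] by (simp add: scale)
  qed simp
  then have "continuous_on UNIV N"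
    by (intro convex_on_continuous) auto
  then have "continuous_on (sphere 0 1) N"
    by (rule continuous_on_subset) simp
  then obtain u where u: "u \<in> sphere 0 1" and least: "\<And>v. v \<in> sphere 0 1 \<Longrightarrow> N u \<le> N v"
    using continuous_attains_inf[of "sphere (0::'a) 1" N] by auto
  show thesis
  proof (rule that)
    show "N u > 0"
      using u by (intro pos) auto
    show "N u * norm z \<le> N z" for z
    proof (cases "z = 0")
      case False
      then have "N u \<le> N ((1 / norm z) *\<^sub>R z)"
        by (intro least) simp
      then show ?thesis
        using False by (simp add: scale field_simps)
    qed (simp add: is_norm_zero[OF assms])
  qed
qed

lemma opt_value_norm_eq_0_if_mem:
  assumes "is_norm N" "0 \<in> S"
  shows "opt_value N S = 0"
proof (rule antisym)
  show "opt_value N S \<le> 0"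
    unfolding opt_value_def using INF_lower[OF assms(2), of "\<lambda>z. ereal (N z)"]
    by (simp add: is_norm_zero[OF assms(1)] zero_ereal_def)
  show "0 \<le> opt_value N S"
    unfolding opt_value_def using assms(1) by (auto intro!: INF_greatest simp: is_norm_def)
qed

text \<open>An empty set has optimal value \<open>\<infinity>\<close>, so optimal value \<open>0\<close> already provides
  the nonemptiness under which attainment yields a minimizer.\<close>

lemma opt_value_norm_eq_0_iff_attained:
  assumes N: "is_norm N" and att: "min_attained N S"
  shows "opt_value N S = 0 \<longleftrightarrow> 0 \<in> S"
proof
  assume opt: "opt_value N S = 0"
  then have "S \<noteq> {}"
    by (auto simp: opt_value_def top_ereal_def)
  then obtain z where z: "z \<in> S" and least: "\<And>w. w \<in> S \<Longrightarrow> N z \<le> N w"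
    using att unfolding min_attained_def is_arg_min_linorder by blast
  have "ereal (N z) \<le> opt_value N S"
    unfolding opt_value_def using least by (auto intro!: INF_greatest)
  then have "N z = 0"
    using opt N unfolding is_norm_def by (metis antisym ereal_less_eq(3) zero_ereal_def)
  then show "0 \<in> S"
    using z N by (auto simp: is_norm_def)
qed (rule opt_value_norm_eq_0_if_mem[OF N])

lemma opt_value_norm_eq_0_iff_closed:
  fixes N :: "'a::euclidean_space \<Rightarrow> real"
  assumes N: "is_norm N" and "closed S"
  shows "opt_value N S = 0 \<longleftrightarrow> 0 \<in> S"
proof
  assume opt: "opt_value N S = 0"
  obtain c where c: "c > 0" and lower: "\<And>z. c * norm z \<le> N z"
    using is_norm_lower_bound[OF N] by blast
  have "\<exists>z\<in>S. dist z 0 < e" if "e > 0" for e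
  proof -
    have "opt_value N S < ereal (c * e)"
      using opt c that by simp
    then obtain z where "z \<in> S" "N z < c * e"
      unfolding opt_value_def by (auto simp: INF_less_iff)
    then have "c * norm z < c * e"
      using lower[of z] by simp
    with \<open>z \<in> S\<close> c show ?thesis
      by auto
  qed
  then show "0 \<in> S"
    using \<open>closed S\<close> closed_approachable by blast
qed (rule opt_value_norm_eq_0_if_mem[OF N])

lemma closed_sub_feasible: "closed (sub_feasible F G x s)"
proof -
  have "sub_feasible F G x s =
      {p. 0 \<le> fst p} \<inter> {p. 0 \<le> snd p} \<inter> {p. G x s \<le> fst p} \<inter> {p. subopt_gap F G x s \<le> ereal (snd p)}"
    by (auto simp: sub_feasible_def)
  then show ?thesis
    by (auto intro!: closed_Int closed_Collect_le continuous_intros)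
qed

text \<open>
  If \<open>x\<close> is feasible, the optimal value is not \<open>\<infinity>\<close>, and gap at most \<open>0\<close> says that \<open>F x s\<close> is a
  lower bound. Feasibility of \<open>x\<close> has to be demanded separately: the gap of an infeasible
  point can be negative.
\<close>

lemma feasible_gap_nonpos_iff_is_arg_min:
  "G x s \<le> 0 \<and> subopt_gap F G x s \<le> 0 \<longleftrightarrow> is_arg_min (\<lambda>y. F y s) (\<lambda>y. G y s \<le> 0) x"
proof -
  have "subopt_gap F G x s \<le> 0 \<longleftrightarrow> ereal (F x s) \<le> opt_value (\<lambda>y. F y s) {y. G y s \<le> 0}"
    unfolding subopt_gap_def
    by (cases "opt_value (\<lambda>y. F y s) {y. G y s \<le> 0}") auto
  also have "\<dots> \<longleftrightarrow> (\<forall>y. G y s \<le> 0 \<longrightarrow> F x s \<le> F y s)"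
    by (simp add: opt_value_def le_INF_iff)
  finally show ?thesis
    by (auto simp: is_arg_min_linorder)
qed

theorem proposition2p1:
  fixes \<Theta> :: "'p::euclidean_space set"
    and f g :: "'p \<Rightarrow> real ^ 'n \<Rightarrow> real ^ 'k \<Rightarrow> real"
    and N :: "real ^ 'n \<Rightarrow> real"
    and M :: "real \<times> real \<Rightarrow> real"
    and \<theta> :: 'p and x :: "real ^ 'n" and s :: "real ^ 'k"
  assumes "is_norm N" and "is_norm M"
    and "\<theta> \<in> \<Theta>"
  shows "(min_attained N (pred_feasible (f \<theta>) (g \<theta>) x s) \<longrightarrow>
            (predictability_loss N (f \<theta>) (g \<theta>) x s = 0 \<longleftrightarrow>
             is_arg_min (\<lambda>y. f \<theta> y s) (\<lambda>y. g \<theta> y s \<le> 0) x)) \<and>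
         (suboptimality_loss M (f \<theta>) (g \<theta>) x s = 0 \<longleftrightarrow>
            is_arg_min (\<lambda>y. f \<theta> y s) (\<lambda>y. g \<theta> y s \<le> 0) x)"
proof (intro conjI impI)
  assume "min_attained N (pred_feasible (f \<theta>) (g \<theta>) x s)"
  then have "predictability_loss N (f \<theta>) (g \<theta>) x s = 0 \<longleftrightarrow> 0 \<in> pred_feasible (f \<theta>) (g \<theta>) x s"
    unfolding predictability_loss_def by (rule opt_value_norm_eq_0_iff_attained[OF assms(1)])
  also have "\<dots> \<longleftrightarrow> is_arg_min (\<lambda>y. f \<theta> y s) (\<lambda>y. g \<theta> y s \<le> 0) x"
    by (simp add: pred_feasible_def flip: feasible_gap_nonpos_iff_is_arg_min)
  finally show "predictability_loss N (f \<theta>) (g \<theta>) x s = 0 \<longleftrightarrow>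
      is_arg_min (\<lambda>y. f \<theta> y s) (\<lambda>y. g \<theta> y s \<le> 0) x" .
next
  have "suboptimality_loss M (f \<theta>) (g \<theta>) x s = 0 \<longleftrightarrow> 0 \<in> sub_feasible (f \<theta>) (g \<theta>) x s"
    unfolding suboptimality_loss_def
    by (rule opt_value_norm_eq_0_iff_closed[OF assms(2) closed_sub_feasible])
  also have "\<dots> \<longleftrightarrow> is_arg_min (\<lambda>y. f \<theta> y s) (\<lambda>y. g \<theta> y s \<le> 0) x"
    by (simp add: sub_feasible_def zero_prod_def flip: zero_ereal_def feasible_gap_nonpos_iff_is_arg_min)
  finally show "suboptimality_loss M (f \<theta>) (g \<theta>) x s = 0 \<longleftrightarrow>
      is_arg_min (\<lambda>y. f \<theta> y s) (\<lambda>y. g \<theta> y s \<le> 0) x" .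
qed

end
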